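(* Let $G$ be a graph of order $n\geq 1$ and maximum degree $\Delta\geq 0$. Then $$\max(n+1,\,2(\Delta+1))\leq \lambda(M(G))\leq (n+1)+\lambda(G).$$
   Context: All graphs are finite, simple and undirected. An $L(2,1)$-labeling of a graph $G=(V,E)$ is a function $f:V\to\{0,1,2,\dots\}$ such that $|f(x)-f(y)|\geq 2$ whenever $d_G(x,y)=1$ and $|f(x)-f(y)|\geq 1$ whenever $d_G(x,y)=2$. The $L(2,1)$-labeling number $\lambda(G)$ is the smallest $k$ such that $G$ has an $L(2,1)$-labeling with all labels in $\{0,\dots,k\}$. For $G$ with $V=\{v_1,\dots,v_n\}$, the Mycielski graph $M(G)$ has vertex set $V\cup V'\cup\{u\}$ with $V'=\{v_1',\dots,v_n'\}$, and edge set $E\cup\{v_iv_j' : v_iv_j\in E\}\cup\{v_i'u: 1\le i\le n\}$. *)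

theory Defs
  imports Complex_Main "Graph_Theory.Graph_Theory"
begin

text \<open>
  A finite simple undirected graph is a \<^locale>\<open>pair_graph\<close>: a finite loop-free symmetric digraph
  without parallel arcs, each undirected edge being represented by its two opposite arcs.
  Hence the out-degree of a vertex is its degree.
\<close>

definition max_degree :: "'a pair_pre_digraph \<Rightarrow> nat" where
  "max_degree G = Max (out_degree (with_proj G) ` pverts G)"

text \<open>Shortest-path distance with unit weights; it is infinite between different components.\<close>

definition graph_dist :: "'a pair_pre_digraph \<Rightarrow> 'a \<Rightarrow> 'a \<Rightarrow> ereal" where
  "graph_dist G x y = wf_digraph.\<mu> (with_proj G) (\<lambda>_. 1) x y"

definition L21_labeling :: "'a pair_pre_digraph \<Rightarrow> ('a \<Rightarrow> nat) \<Rightarrow> bool" where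
  "L21_labeling G f \<longleftrightarrow>
     (\<forall>x\<in>pverts G. \<forall>y\<in>pverts G.
        (graph_dist G x y = 1 \<longrightarrow> \<bar>int (f x) - int (f y)\<bar> \<ge> 2) \<and>
        (graph_dist G x y = 2 \<longrightarrow> \<bar>int (f x) - int (f y)\<bar> \<ge> 1))"

definition L21_number :: "'a pair_pre_digraph \<Rightarrow> nat" where
  "L21_number G = (LEAST k. \<exists>f. L21_labeling G f \<and> f ` pverts G \<subseteq> {0..k})"

datatype 'a mycielski_vertex = Orig 'a | Copy 'a | Apex

definition mycielski :: "'a pair_pre_digraph \<Rightarrow> 'a mycielski_vertex pair_pre_digraph" where
  "mycielski G =
     \<lparr> pverts = Orig ` pverts G \<union> Copy ` pverts G \<union> {Apex},
       parcs = {(Orig x, Orig y) | x y. (x, y) \<in> parcs G}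
             \<union> {(Orig x, Copy y) | x y. (x, y) \<in> parcs G}
             \<union> {(Copy y, Orig x) | x y. (x, y) \<in> parcs G}
             \<union> {(Copy x, Apex) | x. x \<in> pverts G}
             \<union> {(Apex, Copy x) | x. x \<in> pverts G} \<rparr>"

lemma pair_graph_mycielski:
  assumes "pair_graph G"
  shows "pair_graph (mycielski G)"
proof -
  interpret pair_graph G by fact
  have sym: "(y, x) \<in> parcs G" if "(x, y) \<in> parcs G" for x y
    using that pair_sym_arcs by (auto simp: symmetric_def dest: symD)
  have fin: "finite (pverts (mycielski G))"
    using pair_finite_verts by (auto simp: mycielski_def)
  have wf: "fst e \<in> pverts (mycielski G) \<and> snd e \<in> pverts (mycielski G)"
    if "e \<in> parcs (mycielski G)" for e
    using that by (auto simp: mycielski_def dest: in_arcsD1 in_arcsD2)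
  have "parcs (mycielski G) \<subseteq> pverts (mycielski G) \<times> pverts (mycielski G)"
    using wf by (auto simp: mem_Times_iff)
  then have fin': "finite (parcs (mycielski G))"
    using fin by (meson finite_SigmaI finite_subset)
  show ?thesis
  proof
    show "symmetric (with_proj (mycielski G))"
      by (auto simp: symmetric_def mycielski_def intro!: symI dest: sym)
  next
    fix e assume "e \<in> parcs (mycielski G)"
    then show "fst e \<noteq> snd e"
      by (auto simp: mycielski_def dest: pair_no_loops)
  qed (use wf fin fin' in auto)
qed

text \<open>The minimum in the definition of \<^const>\<open>L21_number\<close> is attained.\<close>

lemma L21_labeling_exists:
  assumes "pair_graph G"
  shows "\<exists>k f. L21_labeling G f \<and> f ` pverts G \<subseteq> {0..k}"
proof -
  interpret pair_graph G by fact
  obtain g :: "'a \<Rightarrow> nat" where g: "inj_on g (pverts G)"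
    using finite_imp_inj_to_nat_seg[OF pair_finite_verts] by blast
  have refl: "graph_dist G x x \<le> 0" if "x \<in> pverts G" for x
    using min_cost_le_walk_cost[of x "[]" x "\<lambda>_. 1"] that
    by (simp add: graph_dist_def awalk_Nil_iff zero_ereal_def)
  have "\<bar>int (2 * g x) - int (2 * g y)\<bar> \<ge> 2"
    if "x \<in> pverts G" "y \<in> pverts G" "x \<noteq> y" for x y
    using inj_onD[OF g, of x y] that by linarith
  then have "L21_labeling G (\<lambda>v. 2 * g v)"
    unfolding L21_labeling_def using refl by (fastforce)
  moreover have "(\<lambda>v. 2 * g v) ` pverts G \<subseteq> {0..Max ((\<lambda>v. 2 * g v) ` pverts G)}"
    using pair_finite_verts by auto
  ultimately show ?thesis by blast
qed

end

theory Submission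
  imports Defs
begin

text \<open>
  Lower bound: the copies of the vertices receive distinct labels, none of which is the label of
  the apex or a label next to it. If \<open>v\<close> has degree \<open>\<Delta> \<ge> 1\<close>, then \<open>v\<close>, its copy, the
  apex and the \<open>2\<Delta>\<close> neighbours of \<open>v\<close> in the Mycielski graph are pairwise at distance at most 2,
  so they receive \<open>2\<Delta> + 3\<close> distinct labels.

  Upper bound: let \<open>f\<close> label \<open>G\<close> with span \<open>k\<close> and let \<open>w\<close> maximise \<open>f\<close>. Label the apex 0, each
  original vertex \<open>v\<close> by \<open>f v + 1 \<le> k + 1\<close>, the copy of \<open>w\<close> by \<open>k + 2\<close> and the other copies by
  \<open>k + 3, \<dots>, k + n + 1\<close>. The label \<open>k + 2\<close> is admissible because the neighbours of \<open>w\<close> have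
  \<open>f\<close>-values at most \<open>k - 2\<close>.
\<close>

section \<open>Distances as lengths of shortest walks\<close>

context pair_wf_digraph
begin

lemma awalk_cost_unit: "awalk_cost (\<lambda>_. 1) p = real (length p)"
  by (induction p) auto

lemma graph_dist_le_length:
  assumes "awalk x p y"
  shows "graph_dist G x y \<le> ereal (real (length p))"
  using min_cost_le_walk_cost[OF assms, of "\<lambda>_. 1"]
  by (simp add: graph_dist_def awalk_cost_unit)

text \<open>A finite distance is an infimum over a nonempty set of walks, and lengths are natural
  numbers, so a shortest walk realises it.\<close>

lemma graph_dist_attained:
  assumes "graph_dist G x y \<noteq> \<infinity>"
  obtains p where "awalk x p y" "graph_dist G x y = ereal (real (length p))"
proof -
  have dist: "graph_dist G x y = (INF p\<in>{p. awalk x p y}. ereal (real (length p)))"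
    by (simp add: graph_dist_def \<mu>_def awalk_cost_unit)
  have "{p. awalk x p y} \<noteq> {}"
  proof
    assume "{p. awalk x p y} = {}"
    then have "graph_dist G x y = \<infinity>" unfolding dist by (simp only:) (simp add: top_ereal_def)
    with assms show False ..
  qed
  then obtain p where p: "awalk x p y" "\<And>q. awalk x q y \<Longrightarrow> length p \<le> length q"
    using ex_has_least_nat[of "\<lambda>p. awalk x p y" _ length] by auto
  have "graph_dist G x y = ereal (real (length p))"
    unfolding dist by (rule INF_eqI) (use p in auto)
  with p(1) show ?thesis by (rule that)
qed

end

section \<open>Distances one and two, and labelings, in terms of arcs\<close>

context pair_graph
begin

lemma graph_dist_eq_1_iff: "graph_dist G x y = 1 \<longleftrightarrow> (x, y) \<in> parcs G"
proof
  assume d: "graph_dist G x y = 1"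
  then obtain p where "awalk x p y" "length p = 1"
    using graph_dist_attained[of x y] by (auto simp: one_ereal_def)
  then show "(x, y) \<in> parcs G"
    by (auto simp: length_Suc_conv awalk_simps)
next
  assume xy: "(x, y) \<in> parcs G"
  then have "awalk x [(x, y)] y"
    by (auto simp: awalk_simps dest: in_arcsD1 in_arcsD2)
  from graph_dist_le_length[OF this] have le: "graph_dist G x y \<le> 1"
    by (simp add: one_ereal_def)
  then have "graph_dist G x y \<noteq> \<infinity>" by (auto simp: one_ereal_def)
  then obtain p where p: "awalk x p y" "graph_dist G x y = ereal (real (length p))"
    by (rule graph_dist_attained)
  moreover have "p \<noteq> []"
    using p(1) xy by (auto simp: awalk_simps dest: no_loops')
  ultimately have "length p = 1"
    using le by (cases p) (auto simp: one_ereal_def)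
  with p show "graph_dist G x y = 1" by (simp add: one_ereal_def)
qed

lemma graph_dist_eq_2D:
  assumes "graph_dist G x y = 2"
  shows "x \<noteq> y" and "\<exists>z. (x, z) \<in> parcs G \<and> (z, y) \<in> parcs G"
proof -
  obtain p where p: "awalk x p y" "length p = 2"
    using graph_dist_attained[of x y] assms by auto
  then show "\<exists>z. (x, z) \<in> parcs G \<and> (z, y) \<in> parcs G"
    by (auto simp: length_Suc_conv numeral_2_eq_2 awalk_simps)
  show "x \<noteq> y"
  proof
    assume "x = y"
    then have "awalk x [] y" using p(1) by (auto simp: awalk_Nil_iff)
    from graph_dist_le_length[OF this] assms show False by simp
  qed
qed

text \<open>The two-arc walk bounds the distance by 2, and distinct endpoints exclude 0. Distance 1
  remains possible, when the three vertices form a triangle.\<close>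

lemma graph_dist_common_neighbour:
  assumes "(x, z) \<in> parcs G" "(z, y) \<in> parcs G" "x \<noteq> y"
  shows "graph_dist G x y = 1 \<or> graph_dist G x y = 2"
proof -
  have "awalk x [(x, z), (z, y)] y"
    using assms by (auto simp: awalk_simps dest: in_arcsD1 in_arcsD2)
  from graph_dist_le_length[OF this] have le: "graph_dist G x y \<le> 2" by simp
  then have "graph_dist G x y \<noteq> \<infinity>" by (auto simp: one_ereal_def)
  then obtain p where p: "awalk x p y" "graph_dist G x y = ereal (real (length p))"
    by (rule graph_dist_attained)
  moreover have "p \<noteq> []"
    using p(1) assms by (auto simp: awalk_simps)
  moreover have "length p \<le> 2" using le p(2) by simp
  ultimately have "length p = 1 \<or> length p = 2"
    by (simp add: le_Suc_eq numeral_2_eq_2)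
  with p show ?thesis by (auto simp: one_ereal_def)
qed

text \<open>Trades distances for arcs, so that later arguments only inspect adjacency. The second
  clause also covers adjacent \<open>x\<close> and \<open>y\<close>; this is harmless, since the
  first clause already separates their labels.\<close>

lemma L21_labeling_iff:
  "L21_labeling G f \<longleftrightarrow>
     (\<forall>x y. (x, y) \<in> parcs G \<longrightarrow> \<bar>int (f x) - int (f y)\<bar> \<ge> 2) \<and>
     (\<forall>x y z. (x, z) \<in> parcs G \<longrightarrow> (z, y) \<in> parcs G \<longrightarrow> x \<noteq> y \<longrightarrow> f x \<noteq> f y)"
  (is "?L \<longleftrightarrow> ?A \<and> ?B")
proof
  assume L: ?L
  have ?A
    using L unfolding L21_labeling_def
    by (meson graph_dist_eq_1_iff in_arcsD1 in_arcsD2)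
  moreover have ?B
  proof (intro allI impI)
    fix x y z assume xy: "(x, z) \<in> parcs G" "(z, y) \<in> parcs G" "x \<noteq> y"
    then have "x \<in> pverts G" "y \<in> pverts G" by (auto dest: in_arcsD1 in_arcsD2)
    with L have "graph_dist G x y = 1 \<Longrightarrow> \<bar>int (f x) - int (f y)\<bar> \<ge> 2"
      "graph_dist G x y = 2 \<Longrightarrow> \<bar>int (f x) - int (f y)\<bar> \<ge> 1"
      unfolding L21_labeling_def by blast+
    then show "f x \<noteq> f y"
      using graph_dist_common_neighbour[OF xy] by auto
  qed
  ultimately show "?A \<and> ?B" ..
next
  assume AB: "?A \<and> ?B"
  have "\<bar>int (f x) - int (f y)\<bar> \<ge> 1" if "graph_dist G x y = 2" for x y
  proof -
    have "f x \<noteq> f y" using AB graph_dist_eq_2D[OF that] by blast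
    then show ?thesis by linarith
  qed
  then show ?L
    using AB by (auto simp: L21_labeling_def graph_dist_eq_1_iff)
qed

text \<open>Serves the lower bounds: vertices pairwise joined by one or two arcs need as many labels
  as there are of them.\<close>

lemma L21_labeling_inj_on:
  assumes "L21_labeling G f"
    and "\<And>x y. x \<in> S \<Longrightarrow> y \<in> S \<Longrightarrow> x \<noteq> y \<Longrightarrow>
           (x, y) \<in> parcs G \<or> (\<exists>z. (x, z) \<in> parcs G \<and> (z, y) \<in> parcs G)"
  shows "inj_on f S"
proof (rule inj_onI, rule ccontr)
  fix x y assume "x \<in> S" "y \<in> S" "f x = f y" "x \<noteq> y"
  with assms show False unfolding L21_labeling_iff by fastforce
qed

lemma L21_number_attained:
  obtains f where "L21_labeling G f" "f ` pverts G \<subseteq> {0..L21_number G}"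
  using LeastI_ex[OF L21_labeling_exists[OF pair_graph]] that
  unfolding L21_number_def by blast

lemma degree_max_attained:
  assumes "pverts G \<noteq> {}"
  obtains v where "v \<in> pverts G" "card {w. (v, w) \<in> parcs G} = max_degree G"
proof -
  have "max_degree G \<in> out_degree (with_proj G) ` pverts G"
    unfolding max_degree_def using assms pair_finite_verts by (intro Max_in) auto
  then obtain v where v: "v \<in> pverts G" "max_degree G = out_degree (with_proj G) v" by auto
  have "out_arcs (with_proj G) v = Pair v ` {w. (v, w) \<in> parcs G}" by auto
  then have "out_degree (with_proj G) v = card {w. (v, w) \<in> parcs G}"
    by (simp add: out_degree_def card_image inj_on_def)
  with v that show ?thesis by simp
qed

end

lemma L21_number_le:
  assumes "L21_labeling G f" "f ` pverts G \<subseteq> {0..k}"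
  shows "L21_number G \<le> k"
  unfolding L21_number_def using assms by (intro Least_le) blast

lemma parcs_mycielski [simp]:
  "(Orig x, Orig y) \<in> parcs (mycielski G) \<longleftrightarrow> (x, y) \<in> parcs G"
  "(Orig x, Copy y) \<in> parcs (mycielski G) \<longleftrightarrow> (x, y) \<in> parcs G"
  "(Copy y, Orig x) \<in> parcs (mycielski G) \<longleftrightarrow> (x, y) \<in> parcs G"
  "(Copy x, Apex) \<in> parcs (mycielski G) \<longleftrightarrow> x \<in> pverts G"
  "(Apex, Copy x) \<in> parcs (mycielski G) \<longleftrightarrow> x \<in> pverts G"
  "(Copy x, Copy y) \<notin> parcs (mycielski G)"
  "(Orig x, Apex) \<notin> parcs (mycielski G)"
  "(Apex, Orig x) \<notin> parcs (mycielski G)"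
  "(Apex, Apex) \<notin> parcs (mycielski G)"
  by (auto simp: mycielski_def)

lemma pverts_mycielski:
  "pverts (mycielski G) = Orig ` pverts G \<union> Copy ` pverts G \<union> {Apex}"
  by (simp add: mycielski_def)

section \<open>The two lower bounds and the upper bound for the Mycielski graph\<close>

context pair_graph
begin

interpretation M: pair_graph "mycielski G"
  by (rule pair_graph_mycielski[OF pair_graph])

lemma order_le_L21_number_mycielski:
  assumes "pverts G \<noteq> {}"
  shows "card (pverts G) + 1 \<le> L21_number (mycielski G)"
proof -
  define k where "k = L21_number (mycielski G)"
  obtain f where f: "L21_labeling (mycielski G) f" "f ` pverts (mycielski G) \<subseteq> {0..k}"
    using M.L21_number_attained unfolding k_def by blast
  define a where "a = f Apex"
  \<comment> \<open>A label next to \<open>a\<close>. The predecessor is taken whenever it exists,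
    because \<open>a + 1\<close> might exceed \<open>k\<close>.\<close>
  define b where "b = (if a = 0 then 1 else a - 1)"
  have gap: "\<bar>int (f (Copy x)) - int a\<bar> \<ge> 2" if "x \<in> pverts G" for x
    using f(1) that by (simp add: M.L21_labeling_iff a_def)
  have bound: "f (Copy x) \<le> k" if "x \<in> pverts G" for x
    using subsetD[OF f(2), of "f (Copy x)"] that by (auto simp: pverts_mycielski)
  have "a \<le> k" using f(2) by (auto simp: pverts_mycielski a_def)
  \<comment> \<open>The label of a copy differs from \<open>a\<close> by at least 2, so
    \<open>k\<close> is positive if \<open>a = 0\<close>; this keeps \<open>b = 1\<close> in
    range.\<close>
  moreover obtain x where "x \<in> pverts G" using assms by blast
  with gap[of x] bound[of x] have "1 \<le> k \<or> a \<noteq> 0" by linarith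
  ultimately have ab: "{a, b} \<subseteq> {0..k}" "a \<noteq> b" by (auto simp: b_def)
  have "inj_on f (Copy ` pverts G)"
    by (rule M.L21_labeling_inj_on[OF f(1)]) (auto intro!: exI[of _ Apex])
  then have "card (pverts G) = card (f ` Copy ` pverts G)"
    by (simp add: card_image inj_on_def)
  also have "\<dots> \<le> card ({0..k} - {a, b})"
  proof (rule card_mono)
    have "f (Copy x) \<in> {0..k} - {a, b}" if "x \<in> pverts G" for x
      using gap[OF that] bound[OF that] by (auto simp: b_def split: if_splits)
    then show "f ` Copy ` pverts G \<subseteq> {0..k} - {a, b}" by blast
  qed simp
  also have "\<dots> = k + 1 - 2"
    using ab by (subst card_Diff_subset) auto
  finally have "card (pverts G) \<le> k + 1 - 2" .
  \<comment> \<open>Positivity rules out truncation in \<open>k + 1 - 2\<close>.\<close>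
  moreover have "card (pverts G) > 0" using assms pair_finite_verts by (simp add: card_gt_0_iff)
  ultimately show ?thesis unfolding k_def by linarith
qed

text \<open>The arc to \<open>w\<close> makes the degree positive: \<open>Orig w\<close> links
  \<open>Orig v\<close> to \<open>Copy v\<close>, and \<open>Copy w\<close> links
  \<open>Orig v\<close> to \<open>Apex\<close>. For isolated \<open>v\<close>, \<open>Orig v\<close>
  would be isolated too.\<close>

lemma degree_le_L21_number_mycielski:
  assumes "v \<in> pverts G" "(v, w) \<in> parcs G"
  shows "2 * (card {w. (v, w) \<in> parcs G} + 1) \<le> L21_number (mycielski G)"
proof -
  define k where "k = L21_number (mycielski G)"
  obtain f where f: "L21_labeling (mycielski G) f" "f ` pverts (mycielski G) \<subseteq> {0..k}"
    using M.L21_number_attained unfolding k_def by blast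
  define N where "N = {w. (v, w) \<in> parcs G}"
  define S where "S = (Orig ` N \<union> Copy ` N) \<union> {Orig v, Copy v, Apex}"
  have N: "N \<subseteq> pverts G" "v \<notin> N" "w \<in> N" "finite N"
    using assms finite_subset[OF _ pair_finite_verts, of N]
    by (auto simp: N_def dest: in_arcsD2 no_loops')
  have nb: "(v, x) \<in> parcs G" "(x, v) \<in> parcs G" "x \<in> pverts G" if "x \<in> N" for x
    using that arcs_symmetric in_arcsD2 by (auto simp: N_def)
  have "inj_on f S"
  proof (rule M.L21_labeling_inj_on[OF f(1)])
    fix x y assume xy: "x \<in> S" "y \<in> S" "x \<noteq> y"
    define P where "P x y \<longleftrightarrow> (x, y) \<in> parcs (mycielski G) \<or>
      (\<exists>z. (x, z) \<in> parcs (mycielski G) \<and> (z, y) \<in> parcs (mycielski G))" for x y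
    \<comment> \<open>\<open>Orig v\<close> is adjacent to the originals and the copies of all its
      neighbours, so it joins any two of them.\<close>
    have OO: "P (Orig a) (Orig b)" "P (Orig a) (Copy b)" "P (Copy b) (Orig a)"
      "P (Copy a) (Copy b)" if "a \<in> N" "b \<in> N" for a b
      using nb[OF that(1)] nb[OF that(2)]
      by (auto simp: P_def intro!: exI[of _ "Orig v"])
    have V: "P (Orig v) (Orig a)" "P (Orig v) (Copy a)" "P (Orig a) (Orig v)"
      "P (Copy a) (Orig v)" "P (Copy v) (Orig a)" "P (Orig a) (Copy v)" if "a \<in> N" for a
      using nb[OF that] by (auto simp: P_def)
    have C: "P (Copy v) (Copy a)" "P (Copy a) (Copy v)" "P (Copy a) Apex" "P Apex (Copy a)"
      if "a \<in> N" for a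
      using nb[OF that] assms(1) by (auto simp: P_def intro!: exI[of _ Apex])
    \<comment> \<open>The connecting walk runs through \<open>Copy v\<close>, which is adjacent to
      \<open>Apex\<close> and to every \<open>Orig a\<close>.\<close>
    have A: "P Apex (Orig a)" "P (Orig a) Apex" if "a \<in> N" for a
      using nb[OF that] assms(1) by (auto simp: P_def intro!: exI[of _ "Copy v"])
    have W: "P (Orig v) (Copy v)" "P (Copy v) (Orig v)"
      using nb[OF N(3)] by (auto simp: P_def intro!: exI[of _ "Orig w"])
    have W': "P (Orig v) Apex" "P Apex (Orig v)"
      using nb[OF N(3)] by (auto simp: P_def intro!: exI[of _ "Copy w"])
    have CA: "P (Copy v) Apex" "P Apex (Copy v)"
      using assms(1) by (auto simp: P_def)
    have "P x y"
      using xy unfolding S_def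
      by (elim UnE imageE insertE emptyE) (simp_all add: OO V C A W W' CA)
    then show "(x, y) \<in> parcs (mycielski G) \<or>
      (\<exists>z. (x, z) \<in> parcs (mycielski G) \<and> (z, y) \<in> parcs (mycielski G))"
      by (simp add: P_def)
  qed
  then have "card S = card (f ` S)" by (simp add: card_image)
  also have "\<dots> \<le> card {0..k}"
  proof (rule card_mono)
    have "S \<subseteq> pverts (mycielski G)"
      using N assms(1) by (auto simp: S_def pverts_mycielski)
    then show "f ` S \<subseteq> {0..k}" using f(2) by blast
  qed simp
  finally have "card S \<le> k + 1" by simp
  moreover have "card S = 2 * card N + 3"
  proof -
    have "card (Orig ` N \<union> Copy ` N) = card (Orig ` N) + card (Copy ` N)"
      by (rule card_Un_disjoint) (use N(4) in auto)
    also have "\<dots> = 2 * card N" by (simp add: card_image inj_on_def)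
    finally show ?thesis
      unfolding S_def using N(2,4) by (subst card_Un_disjoint) auto
  qed
  ultimately show ?thesis by (simp add: k_def N_def)
qed

text \<open>Starting all copies at \<open>k + 3\<close> would cost one label more than the bound
  allows. A copy needs a gap of 2 only to the originals adjacent to it, so \<open>Copy w\<close> can
  use \<open>k + 2\<close>.\<close>

lemma L21_number_mycielski_le:
  assumes "pverts G \<noteq> {}"
  shows "L21_number (mycielski G) \<le> card (pverts G) + 1 + L21_number G"
proof -
  define k where "k = L21_number G"
  define n where "n = card (pverts G)"
  obtain f where f: "L21_labeling G f" "f ` pverts G \<subseteq> {0..k}"
    using L21_number_attained unfolding k_def by blast
  have fk: "f x \<le> k" if "x \<in> pverts G" for x using f(2) that by auto
  have "Max (f ` pverts G) \<in> f ` pverts G"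
    using assms pair_finite_verts by (intro Max_in) auto
  then obtain w where "w \<in> pverts G" "Max (f ` pverts G) = f w" by auto
  then have w: "w \<in> pverts G" "\<And>x. x \<in> pverts G \<Longrightarrow> f x \<le> f w"
    using Max_ge[OF finite_imageI[OF pair_finite_verts, of f]] by auto
  obtain h where "bij_betw h (pverts G - {w}) {0..<card (pverts G - {w})}"
    using ex_bij_betw_finite_nat pair_finite_verts by (metis finite_Diff)
  moreover have "card (pverts G - {w}) = n - 1" by (simp add: n_def w(1) card_Diff_singleton)
  ultimately have h: "bij_betw h (pverts G - {w}) {0..<n - 1}" by simp
  then have h_inj: "h x \<noteq> h y" if "x \<in> pverts G" "y \<in> pverts G" "x \<noteq> w" "y \<noteq> w" "x \<noteq> y" for x y
    using that by (auto simp: bij_betw_def inj_on_def)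
  have h_less: "h x < n - 1" if "x \<in> pverts G" "x \<noteq> w" for x
    using that h by (auto simp: bij_betw_def)
  \<comment> \<open>Since \<open>h\<close> stays below \<open>n - 1\<close>, no value on
    \<open>pverts G\<close> exceeds \<open>k + n + 1\<close>.\<close>
  define c where "c x = (if x = w then k + 2 else k + 3 + h x)" for x
  have c_inj: "c x \<noteq> c y" if "x \<in> pverts G" "y \<in> pverts G" "x \<noteq> y" for x y
    using that h_inj by (auto simp: c_def)
  have c_ge: "k + 2 \<le> c x" for x by (simp add: c_def)
  have "n \<ge> 1" using w(1) pair_finite_verts by (auto simp: n_def Suc_le_eq card_gt_0_iff)
  then have c_le: "c x \<le> n + 1 + k" if "x \<in> pverts G" for x
    using that h_less[of x] by (auto simp: c_def)
  have f2: "\<bar>int (f x) - int (f y)\<bar> \<ge> 2" if "(x, y) \<in> parcs G" for x y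
    using f(1) that by (simp add: L21_labeling_iff)
  \<comment> \<open>The constant 3 is the required gap 2 plus the shift by 1 that the originals
    receive in \<open>g\<close>.\<close>
  have fc: "f x + 3 \<le> c y" if "(x, y) \<in> parcs G" for x y
  proof (cases "y = w")
    case True
    have "f x \<le> f w" "f w \<le> k" using that w fk in_arcsD1 by auto
    then show ?thesis using f2[OF that] True by (simp add: c_def)
  next
    case False
    then show ?thesis using fk[OF in_arcsD1[OF that]] by (simp add: c_def)
  qed
  \<comment> \<open>No original is adjacent to the apex, so a shift by 1 is enough to reserve 0 for
    the apex.\<close>
  define g where "g = case_mycielski_vertex (\<lambda>x. f x + 1) c 0"
  have g: "g (Orig x) = f x + 1" "g (Copy x) = c x" "g Apex = 0" for x
    by (simp_all add: g_def)
  have "L21_labeling (mycielski G) g"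
    unfolding M.L21_labeling_iff
  proof (intro conjI allI impI)
    fix x y assume "(x, y) \<in> parcs (mycielski G)"
    then show "\<bar>int (g x) - int (g y)\<bar> \<ge> 2"
    proof (cases x; cases y)
      fix a b assume "x = Orig a" "y = Copy b"
      with \<open>(x, y) \<in> _\<close> fc[of a b] show ?thesis by (simp add: g)
    next
      fix a b assume "x = Copy a" "y = Orig b"
      with \<open>(x, y) \<in> _\<close> fc[of b a] show ?thesis by (simp add: g)
    next
      fix a assume "x = Copy a" "y = Apex"
      with c_ge[of a] show ?thesis by (simp add: g)
    next
      fix a assume "x = Apex" "y = Copy a"
      with c_ge[of a] show ?thesis by (simp add: g)
    qed (use f2 in \<open>auto simp: g\<close>)
  next
    fix x y z
    assume xz: "(x, z) \<in> parcs (mycielski G)" and zy: "(z, y) \<in> parcs (mycielski G)"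
      and "x \<noteq> y"
    have xy: "x \<in> pverts (mycielski G)" "y \<in> pverts (mycielski G)"
      using M.in_arcsD1[OF xz] M.in_arcsD2[OF zy] by auto
    have OC: "f a + 1 < c b" if "a \<in> pverts G" for a b
      using fk[OF that] c_ge[of b] by simp
    show "g x \<noteq> g y"
    proof (cases x; cases y)
      fix a b assume "x = Orig a" "y = Orig b"
      \<comment> \<open>The middle vertex \<open>z\<close> is \<open>Orig d\<close> or
        \<open>Copy d\<close>, never \<open>Apex\<close>; in both cases \<open>d\<close> is a common
        neighbour in \<open>G\<close>.\<close>
      moreover have "\<exists>d. (a, d) \<in> parcs G \<and> (d, b) \<in> parcs G"
        using xz zy calculation by (cases z) (auto dest: arcs_symmetric)
      ultimately show ?thesis
        using f(1) \<open>x \<noteq> y\<close> by (auto simp: g L21_labeling_iff)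
    next
      fix a b assume "x = Orig a" "y = Copy b"
      with xy OC[of a b] show ?thesis by (auto simp: g pverts_mycielski)
    next
      fix a b assume "x = Copy a" "y = Orig b"
      with xy OC[of b a] show ?thesis by (auto simp: g pverts_mycielski)
    next
      fix a b assume "x = Copy a" "y = Copy b"
      with xy c_inj[of a b] \<open>x \<noteq> y\<close> show ?thesis by (auto simp: g pverts_mycielski)
    next
      fix a assume "x = Copy a" "y = Apex"
      with c_ge[of a] show ?thesis by (simp add: g)
    next
      fix a assume "x = Apex" "y = Copy a"
      with c_ge[of a] show ?thesis by (simp add: g)
    qed (use \<open>x \<noteq> y\<close> in \<open>auto simp: g\<close>)
  qed
  moreover have "g ` pverts (mycielski G) \<subseteq> {0..n + 1 + k}"
    using fk c_le by (fastforce simp: pverts_mycielski g)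
  ultimately show ?thesis
    unfolding k_def n_def by (rule L21_number_le)
qed

end

theorem theorem3p1:
  fixes G :: "'a pair_pre_digraph" and n \<Delta> :: nat
  assumes "pair_graph G"
    and "n = card (pverts G)" and "n \<ge> 1"
    and "\<Delta> = max_degree G"
  shows "max (n + 1) (2 * (\<Delta> + 1)) \<le> L21_number (mycielski G)
       \<and> L21_number (mycielski G) \<le> (n + 1) + L21_number G"
proof -
  interpret pair_graph G by fact
  have ne: "pverts G \<noteq> {}" using assms(2,3) by auto
  have lower: "n + 1 \<le> L21_number (mycielski G)"
    using order_le_L21_number_mycielski[OF ne] assms(2) by simp
  obtain v where v: "v \<in> pverts G" "card {w. (v, w) \<in> parcs G} = \<Delta>"
    using degree_max_attained[OF ne] assms(4) by metis
  have "2 * (\<Delta> + 1) \<le> L21_number (mycielski G)"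
  proof (cases "\<Delta> = 0")
    case True
    with lower assms(3) show ?thesis by simp
  next
    case False
    with v(2) have "{w. (v, w) \<in> parcs G} \<noteq> {}" by (metis card.empty)
    then obtain w where "(v, w) \<in> parcs G" by blast
    from degree_le_L21_number_mycielski[OF v(1) this] v(2) show ?thesis by simp
  qed
  with lower L21_number_mycielski_le[OF ne] assms(2) show ?thesis by simp
qed

end
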